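(* Let $M>\frac23$ and $\alpha\in\mathbb{R}$. If $U=\mathrm{diag}(\lambda_1,\lambda_1,\lambda_2)$ with $\lambda_1,\lambda_2>0$, then $T_{\rm Biot}(U)=\alpha\,\mathbb{1}$ holds if and only if either $\lambda_1=\lambda_2$ and $U$ is the radial solution, or $$\lambda_2=\frac{\sqrt{(9M^2+6M-8)\lambda_1^4+9\lambda_1^2}+3\lambda_1}{(3M-2)\lambda_1^4}$$ with $\lambda_1$ being a solution of $\ell(\lambda_1)=\alpha$, where $$\ell:(0,\infty)\to(0,\infty),\qquad \ell(\lambda_1)=\frac{\sqrt{(9M^2+6M-8)\lambda_1^4+9\lambda_1^2}+(3M-2)\lambda_1^5+3\lambda_1}{(3M-2)\lambda_1^4}.$$ For any $M>\frac23$ the function $\ell$ is convex, and $\lim_{\lambda_1\to0}\ell(\lambda_1)=\infty=\lim_{\lambda_1\to\infty}\ell(\lambda_1)$. Thus: (i) For $\alpha<\min_{\lambda_1>0}\ell(\lambda_1)$ the equation $\ell(\lambda_1)=\alpha$ has no solutions. Therefore, only the radial solution, which always exists, is a solution of $T_{\rm Biot}(U)=\alpha\,\mathbb{1}$. (ii) For $\alpha=\min_{\lambda_1>0}\ell(\lambda_1)$ the equation $\ell(\lambda_1)=\alpha$ has one solution. Hence, the equation $T_{\rm Biot}(U)=\alpha\,\mathbb{1}$ has two solutions: one radial and another with two equal eigenvalues. (iii) For all $\alpha>\min_{\lambda_1>0}\ell(\lambda_1)$ the equation $\ell(\lambda_1)=\alpha$ has two different admissible solutions, which lead to two non-radial admissible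 solutions of $T_{\rm Biot}(U)=\alpha\,\mathbb{1}$. Besides these two solutions there is the radial solution, too.
   Context: $\mathrm{Sym}^{++}(3)$ is the set of real symmetric positive definite $3\times3$ matrices and $\mathbb{1}$ is the $3\times3$ identity matrix. For $M>\frac23$, the Biot stress tensor of the one-parameter Neo-Hooke-Ciarlet-Geymonat energy $\frac12\|U\|^2-\log\det U+\left(\frac M4-\frac16\right)\left((\det U)^2-2\log\det U-1\right)$ is, for $U\in\mathrm{Sym}^{++}(3)$, $$T_{\rm Biot}(U)=U+\Big[\Big(\tfrac M2-\tfrac13\Big)\Big(\det U-\tfrac1{\det U}\Big)-\tfrac1{\det U}\Big](\det U)\,U^{-1}.$$ For every $\alpha\in\mathbb{R}$ the equation $T_{\rm Biot}(U)=\alpha\mathbb{1}$ has exactly one radial solution, i.e. a solution of the form $U=\beta\mathbb{1}$ with $\beta>0$; this is "the radial solution". The solutions under consideration are those of the form $U=\mathrm{diag}(\lambda_1,\lambda_1,\lambda_2)$ with $\lambda_1,\lambda_2>0$; such a solution is non-radial if $\lambda_1\neq\lambda_2$. "Admissible" means that the stretches are positive.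
   Formalization: In (iii), two non-radial solutions besides the radial one are claimed for all α > min ℓ except one value α0 (M=32/21: α0=2√2), where the smaller root of ℓ=α gives the radial solution (λ1=λ2), so only one non-radial solution remains; the exact solution set is stated there. *)

theory Defs
  imports "HOL-Analysis.Analysis"
begin

definition Sym_pp :: "(real^3^3) set" where
  "Sym_pp = {U. transpose U = U \<and> (\<forall>x. x \<noteq> 0 \<longrightarrow> x \<bullet> (U *v x) > 0)}"

definition diag3 :: "real \<Rightarrow> real \<Rightarrow> real \<Rightarrow> real^3^3" where
  "diag3 a b c = (\<chi> i j. if i = j then vector [a, b, c] $ i else 0)"

definition T_Biot :: "real \<Rightarrow> real^3^3 \<Rightarrow> real^3^3" where
  "T_Biot M U =
     U + (((M/2 - 1/3) * (det U - 1 / det U) - 1 / det U) * det U) *\<^sub>R matrix_inv U"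

definition solutions :: "real \<Rightarrow> real \<Rightarrow> (real^3^3) set" where
  "solutions M \<alpha> = {U \<in> Sym_pp. T_Biot M U = \<alpha> *\<^sub>R mat 1}"

definition is_radial :: "real^3^3 \<Rightarrow> bool" where
  "is_radial U \<longleftrightarrow> (\<exists>\<beta>>0. U = \<beta> *\<^sub>R mat 1)"

text \<open>Meaningful because exactly one radial solution exists whenever \<open>M > 2/3\<close>;
  this is part of the main statement.\<close>

definition radial_solution :: "real \<Rightarrow> real \<Rightarrow> real^3^3" where
  "radial_solution M \<alpha> = (THE U. U \<in> solutions M \<alpha> \<and> is_radial U)"

definition axi_solutions :: "real \<Rightarrow> real \<Rightarrow> (real^3^3) set" where
  "axi_solutions M \<alpha> =
     {U \<in> solutions M \<alpha>. \<exists>x>0. \<exists>y>0. U = diag3 x x y}"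

definition nonradial_solutions :: "real \<Rightarrow> real \<Rightarrow> (real^3^3) set" where
  "nonradial_solutions M \<alpha> =
     {U \<in> solutions M \<alpha>. \<exists>x>0. \<exists>y>0. x \<noteq> y \<and> U = diag3 x x y}"

text \<open>The relation between the stretches of \<open>diag3 x x y\<close> obtained by dividing the difference of the two
  scalar equations by \<open>x - y\<close>.\<close>

definition lambda2 :: "real \<Rightarrow> real \<Rightarrow> real" where
  "lambda2 M x =
     (sqrt ((9 * M^2 + 6 * M - 8) * x^4 + 9 * x^2) + 3 * x) / ((3 * M - 2) * x^4)"

definition ell :: "real \<Rightarrow> real \<Rightarrow> real" where
  "ell M x =
     (sqrt ((9 * M^2 + 6 * M - 8) * x^4 + 9 * x^2) + (3 * M - 2) * x^5 + 3 * x)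
       / ((3 * M - 2) * x^4)"

text \<open>That this minimum is attained is part of the main statement.\<close>

definition ell_min :: "real \<Rightarrow> real" where
  "ell_min M = (LEAST y. y \<in> ell M ` {0<..})"

definition branch :: "real \<Rightarrow> real \<Rightarrow> real^3^3" where
  "branch M x = diag3 x x (lambda2 M x)"

text \<open>Every point \<open>branch M x\<close> with \<open>x > 0\<close> solves the equation for \<open>\<alpha> = ell M x\<close>, but
  \<open>lambda2 M x = x\<close> happens for exactly one \<open>x > 0\<close>, namely the positive root of
  \<open>(3 * M - 2) * (x^6 - 1) = 6 * x^2 + 6\<close>. For the corresponding value of \<open>\<alpha>\<close>, which exceeds
  the minimum of \<open>ell M\<close>, the branch point is the radial solution itself, so only one
  non-radial solution remains. The main statement therefore treats that single value
  separately, as \<open>\<alpha>0\<close>.\<close>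

end

theory Submission
  imports Defs
begin

text \<open>With \<open>c = M/2 - 1/3\<close>, \<open>d = det U\<close> and \<open>P = c * (d^2 - 1) - 1\<close> the stress is \<open>U + P U^{-1}\<close>, so
  \<open>diag(x, x, y)\<close> solves the equation iff \<open>x + P/x = y + P/y = \<alpha>\<close>. For \<open>x \<noteq> y\<close> this says \<open>P = x * y\<close> and
  \<open>\<alpha> = x + y\<close>; the former is quadratic in \<open>y\<close> with \<open>lambda2 M x\<close> as its only positive root. Since
  \<open>lambda2 M\<close> is strictly convex, \<open>ell M x = x + lambda2 M x\<close> is strictly convex and coercive, which
  gives the solution counts. The branch meets the radial solutions where \<open>lambda2 M x = x\<close>; there
  \<open>ell M\<close> still has smaller values further to the right, so this point is on the decreasing part.\<close>

section \<open>Diagonal matrices and reduction to scalar equations\<close>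

lemma scaleR_mat_eq_diag3: "\<beta> *\<^sub>R mat 1 = diag3 \<beta> \<beta> \<beta>"
  by (simp add: diag3_def vec_eq_iff forall_3 mat_def)

lemma diag3_eq_iff: "diag3 a b c = diag3 a' b' c' \<longleftrightarrow> a = a' \<and> b = b' \<and> c = c'"
  by (auto simp: diag3_def vec_eq_iff forall_3)

lemma det_diag3: "det (diag3 a b c) = a * b * c"
  by (simp add: det_3 diag3_def)

lemma diag3_mult: "diag3 a b c ** diag3 a' b' c' = diag3 (a * a') (b * b') (c * c')"
  by (simp add: diag3_def vec_eq_iff forall_3 matrix_matrix_mult_def sum_3)

lemma matrix_inv_diag3:
  assumes "a \<noteq> 0" "b \<noteq> 0" "c \<noteq> 0"
  shows "matrix_inv (diag3 a b c) = diag3 (1 / a) (1 / b) (1 / c)"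
proof -
  have one: "diag3 1 1 1 = mat 1" using scaleR_mat_eq_diag3[of 1] by simp
  have "diag3 a b c ** diag3 (1 / a) (1 / b) (1 / c) = mat 1 \<and>
      diag3 (1 / a) (1 / b) (1 / c) ** diag3 a b c = mat 1"
    using assms by (simp add: diag3_mult one)
  \<comment> \<open>\<open>matrix_inv\<close> is a Hilbert choice, so the explicit inverse serves
    first as the existence witness; uniqueness of inverses then identifies the chosen matrix with
    it.\<close>
  then have inv: "matrix_inv (diag3 a b c) ** diag3 a b c = mat 1"
    unfolding matrix_inv_def by (rule someI2) simp
  have "matrix_inv (diag3 a b c) =
      matrix_inv (diag3 a b c) ** (diag3 a b c ** diag3 (1 / a) (1 / b) (1 / c))"
    using assms by (simp add: diag3_mult one)
  also have "\<dots> = diag3 (1 / a) (1 / b) (1 / c)"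
    by (simp add: matrix_mul_assoc inv)
  finally show ?thesis .
qed

lemma diag3_in_Sym_pp:
  assumes "a > 0" "b > 0" "c > 0"
  shows "diag3 a b c \<in> Sym_pp"
proof -
  have "transpose (diag3 a b c) = diag3 a b c"
    by (simp add: transpose_def diag3_def vec_eq_iff forall_3)
  moreover have "x \<bullet> (diag3 a b c *v x) > 0" if "x \<noteq> 0" for x
  proof -
    have "x \<bullet> (diag3 a b c *v x) = a * (x$1)\<^sup>2 + b * (x$2)\<^sup>2 + c * (x$3)\<^sup>2"
      by (simp add: inner_vec_def sum_3 matrix_vector_mult_def diag3_def power2_eq_square)
    moreover have "x$1 \<noteq> 0 \<or> x$2 \<noteq> 0 \<or> x$3 \<noteq> 0"
      using that by (auto simp: vec_eq_iff forall_3)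
    ultimately show ?thesis
      using assms
      by (smt (verit, best) mult_pos_pos mult_nonneg_nonneg zero_less_power2 zero_le_power2)
  qed
  ultimately show ?thesis by (simp add: Sym_pp_def)
qed

text \<open>The coefficient of \<open>matrix_inv U\<close> in \<open>T_Biot\<close>, multiplied out
  so that no division by the determinant \<open>d\<close> remains. Being polynomial, it can also be
  evaluated at \<open>d = 0\<close>.\<close>

definition pressure :: "real \<Rightarrow> real \<Rightarrow> real" where
  "pressure M d = (M/2 - 1/3) * (d\<^sup>2 - 1) - 1"

lemma T_Biot_diag3_iff:
  assumes "x > 0" "y > 0"
  shows "T_Biot M (diag3 x x y) = \<alpha> *\<^sub>R mat 1 \<longleftrightarrow>
    x + pressure M (x * x * y) / x = \<alpha> \<and> y + pressure M (x * x * y) / y = \<alpha>"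
proof -
  define d where "d = x * x * y"
  have "((M/2 - 1/3) * (d - 1 / d) - 1 / d) * d = pressure M d"
    using assms by (simp add: d_def pressure_def field_simps power2_eq_square)
  then have "T_Biot M (diag3 x x y) = diag3 x x y + pressure M d *\<^sub>R diag3 (1/x) (1/x) (1/y)"
    using assms by (simp add: T_Biot_def det_diag3 matrix_inv_diag3 d_def)
  also have "\<dots> = diag3 (x + pressure M d / x) (x + pressure M d / x) (y + pressure M d / y)"
    by (simp add: diag3_def vec_eq_iff forall_3)
  finally show ?thesis by (simp add: scaleR_mat_eq_diag3 diag3_eq_iff d_def)
qed

section \<open>Level sets of strictly convex coercive functions\<close>

text \<open>Coercivity yields a minimiser; strict convexity makes the function strictly monotone on both
  sides of it.\<close>

lemma strictly_convex_coercive_levels: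
  fixes f :: "real \<Rightarrow> real"
  assumes cont: "continuous_on {0<..} f"
    and strict: "\<And>u v x y. \<lbrakk>u > 0; v > 0; u + v = 1; x > 0; y > 0; x \<noteq> y\<rbrakk> \<Longrightarrow>
      f (u * x + v * y) < u * f x + v * f y"
    and lim0: "filterlim f at_top (at_right 0)"
    and lim_top: "filterlim f at_top at_top"
  obtains m where "m > 0" "\<And>x. \<lbrakk>x > 0; x \<noteq> m\<rbrakk> \<Longrightarrow> f m < f x"
    "\<And>\<alpha>. \<alpha> > f m \<Longrightarrow> \<exists>a b. 0 < a \<and> a < m \<and> m < b \<and> {x. x > 0 \<and> f x = \<alpha>} = {a, b} \<and>
      (\<forall>x>b. f x > \<alpha>)"
proof -
  have small: "\<exists>e>0. e < c \<and> (\<forall>x. 0 < x \<and> x \<le> e \<longrightarrow> f x > K)" if "c > 0" for K c :: real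
  proof -
    have "eventually (\<lambda>x. f x > K) (at_right 0)"
      using lim0 by (simp add: filterlim_at_top_dense)
    then obtain b where b: "b > 0" "\<And>x. 0 < x \<Longrightarrow> x < b \<Longrightarrow> f x > K"
      unfolding eventually_at_right_field by auto
    with that show ?thesis by (intro exI[of _ "min b c / 2"]) auto
  qed
  have large: "\<exists>r>c. \<forall>x\<ge>r. f x > K" for K c
  proof -
    have "eventually (\<lambda>x. f x > K) at_top"
      using lim_top by (simp add: filterlim_at_top_dense)
    then obtain r where "\<And>x. x \<ge> r \<Longrightarrow> f x > K"
      unfolding eventually_at_top_linorder by auto
    then show ?thesis by (intro exI[of _ "max r (c + 1)"]) auto
  qed
  \<comment> \<open>Outside \<open>{e..r}\<close> the values exceed \<open>f 1\<close>, and 1 lies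
    inside, so a minimiser on this compact interval is a global one.\<close>
  obtain e where e: "e > 0" "e < 1" "\<And>x. 0 < x \<Longrightarrow> x \<le> e \<Longrightarrow> f x > f 1"
    using small[of 1 "f 1"] by auto
  obtain r where r: "r > 1" "\<And>x. x \<ge> r \<Longrightarrow> f x > f 1"
    using large[of 1 "f 1"] by auto
  have "continuous_on {e..r} f"
    using cont by (rule continuous_on_subset) (use e in auto)
  then obtain m where m: "m \<in> {e..r}" "\<And>x. x \<in> {e..r} \<Longrightarrow> f m \<le> f x"
    using continuous_attains_inf[of "{e..r}" f] e r by auto
  have mpos: "m > 0" using m(1) e by auto
  have m1: "f m \<le> f 1" using m e r by auto
  have min: "f m \<le> f x" if "x > 0" for x
    using m(2)[of x] e(3)[of x] r(2)[of x] m1 that by (cases "x < e"; cases "x > r") auto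
  \<comment> \<open>Strict quasiconvexity; the rest of the argument uses convexity only through this
    inequality.\<close>
  have conv3: "f z < max (f x) (f y)" if "0 < x" "x < z" "z < y" for x y z
  proof -
    define u where "u = (y - z) / (y - x)"
    have u: "u > 0" "1 - u > 0" using that by (auto simp: u_def field_simps)
    have "z - y = u * (x - y)" using that by (simp add: u_def field_simps)
    then have z: "u * x + (1 - u) * y = z" by (simp add: algebra_simps)
    have "f z < u * f x + (1 - u) * f y"
      using strict[of u "1 - u" x y] u z that by simp
    also have "\<dots> \<le> u * max (f x) (f y) + (1 - u) * max (f x) (f y)"
      using u by (intro add_mono mult_left_mono) auto
    also have "\<dots> = max (f x) (f y)" by (simp add: algebra_simps)
    finally show ?thesis .
  qed
  \<comment> \<open>If another point also attained the minimum, the midpoint between it and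
    \<open>m\<close> would have a smaller value.\<close>
  have smin: "f m < f x" if "x > 0" "x \<noteq> m" for x
  proof -
    have "f ((x + m) / 2) < max (f x) (f m)"
    proof (cases "x < m")
      case True
      then show ?thesis using that conv3[of x "(x + m) / 2" m] by auto
    next
      case False
      then show ?thesis using that mpos conv3[of m "(x + m) / 2" x] by (auto simp: max.commute)
    qed
    moreover have "f m \<le> f ((x + m) / 2)" using min that mpos by auto
    ultimately show ?thesis by (auto simp: max_def split: if_splits)
  qed
  \<comment> \<open>For \<open>y\<close> strictly between \<open>x\<close> and \<open>m\<close>,
    quasiconvexity gives f y < max (f x) (f m), and this maximum is \<open>f x\<close>;
    \<open>inc\<close> is the mirror image.\<close>
  have dec: "f y < f x" if "0 < x" "x < y" "y \<le> m" for x y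
    using that conv3[of x y m] smin[of x] smin[of y] by (cases "y = m") (auto simp: max_def split: if_splits)
  have inc: "f x < f y" if "m \<le> x" "x < y" for x y
    using that mpos conv3[of m x y] smin[of x] smin[of y] by (cases "x = m") (auto simp: max_def split: if_splits)
  show ?thesis
  proof (rule that[OF mpos smin])
    fix \<alpha> assume \<alpha>: "\<alpha> > f m"
    obtain l where l: "0 < l" "l < m" "f l > \<alpha>" using small[OF mpos, of \<alpha>] by auto
    obtain h where h: "h > m" "f h > \<alpha>" using large[of m \<alpha>] by auto
    have "continuous_on {l..m} f" "continuous_on {m..h} f"
      using cont by (rule continuous_on_subset; use l mpos in auto)+
    then obtain a b where a: "l \<le> a" "a \<le> m" "f a = \<alpha>" and b: "m \<le> b" "b \<le> h" "f b = \<alpha>"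
      using IVT2'[of f m \<alpha> l] IVT'[of f m \<alpha> h] l h \<alpha> by (auto simp: less_imp_le)
    have ab: "0 < a" "a < m" "m < b" using a b l \<alpha> by (auto simp: less_le)
    have "x = a \<or> x = b" if "x > 0" "f x = \<alpha>" for x
    proof (cases "x \<le> m")
      case True
      then show ?thesis using dec[of x a] dec[of a x] that a ab by (cases x a rule: linorder_cases) auto
    next
      case False
      then show ?thesis using inc[of x b] inc[of b x] that b ab by (cases x b rule: linorder_cases) auto
    qed
    then have "{x. x > 0 \<and> f x = \<alpha>} = {a, b}" using a b ab by auto
    moreover have "\<forall>x>b. f x > \<alpha>" using inc[of b] ab b by auto
    ultimately show "\<exists>a b. 0 < a \<and> a < m \<and> m < b \<and> {x. x > 0 \<and> f x = \<alpha>} = {a, b} \<and>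
      (\<forall>x>b. f x > \<alpha>)"
      using ab by blast
  qed auto
qed

section \<open>Strict convexity and positivity of the second stretch\<close>

lemma sqrt_arg_factor: "9 * M\<^sup>2 + 6 * M - 8 = (3 * M - 2) * (3 * M + 4)" for M :: real
  by (simp add: algebra_simps power2_eq_square)

text \<open>After cross-multiplication the gap between the two sides is exactly
  \<open>u * v * (x - y)^2\<close>.\<close>

lemma strictly_convex_inverse:
  fixes u v x y :: real
  assumes "u > 0" "v > 0" "u + v = 1" "x > 0" "y > 0" "x \<noteq> y"
  shows "1 / (u * x + v * y) < u * (1 / x) + v * (1 / y)"
proof -
  have v: "v = 1 - u" using assms by simp
  have "(u * x + v * y) * (u * y + v * x) = x * y + u * v * (x - y)\<^sup>2"
    unfolding v by (simp add: algebra_simps power2_eq_square)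
  moreover have "u * v * (x - y)\<^sup>2 > 0" using assms by simp
  ultimately have "x * y < (u * x + v * y) * (u * y + v * x)" by linarith
  moreover have "u * x + v * y > 0" using assms by (simp add: add_pos_pos)
  ultimately show ?thesis using assms by (simp add: field_simps)
qed

lemma convex_on_power_nonneg: "convex_on {0::real..} (\<lambda>x. x ^ n)"
  by (cases "even n") (auto intro: convex_on_subset[OF convex_power_even] convex_power_odd)

lemma ell_eq:
  assumes "M > 2/3" "x > 0"
  shows "ell M x = x + lambda2 M x"
proof -
  have "(3 * M - 2) * x ^ 5 = x * ((3 * M - 2) * x ^ 4)" by (simp add: eval_nat_numeral)
  then show ?thesis using assms by (simp add: ell_def lambda2_def add_divide_distrib)
qed

text \<open>Pulling \<open>x^4\<close> into the root leaves a sum of squares of monomials in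
  \<open>1/x\<close> with nonnegative coefficients. Both the convexity and the monotonicity of
  \<open>lambda2 M\<close> are read off from this form.\<close>

lemma lambda2_eq:
  assumes "M > 2/3" "x > 0"
  shows "(3 * M - 2) * lambda2 M x =
    sqrt ((3 * (1/x)^3)\<^sup>2 + (sqrt (9 * M\<^sup>2 + 6 * M - 8) * (1/x)\<^sup>2)\<^sup>2) + 3 * (1/x)^3"
proof -
  define K where "K = 9 * M\<^sup>2 + 6 * M - 8"
  have K: "K \<ge> 0" using assms by (simp add: K_def sqrt_arg_factor)
  have "(3 * (1/x)^3)\<^sup>2 + (sqrt K * (1/x)\<^sup>2)\<^sup>2 = (K * x^4 + 9 * x\<^sup>2) / (x^4)\<^sup>2"
    using assms K by (simp add: power_mult_distrib field_simps)
  then have "sqrt ((3 * (1/x)^3)\<^sup>2 + (sqrt K * (1/x)\<^sup>2)\<^sup>2) = sqrt (K * x^4 + 9 * x\<^sup>2) / x^4"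
    using assms by (simp only: real_sqrt_divide real_sqrt_abs abs_of_nonneg zero_le_power less_imp_le)
  moreover have "3 * (1/x)^3 = 3 * x / x^4" using assms by (simp add: field_simps eval_nat_numeral)
  moreover have "(3 * M - 2) * lambda2 M x = sqrt (K * x^4 + 9 * x\<^sup>2) / x^4 + 3 * x / x^4"
    using assms by (simp add: lambda2_def K_def flip: add_divide_distrib)
  ultimately show ?thesis by (simp only: K_def)
qed

text \<open>By \<open>lambda2_eq\<close> the function is, up to a factor, \<open>f\<close> plus the Euclidean norm of \<open>(f, g)\<close> with
  \<open>f\<close> strictly convex and \<open>g\<close> convex, both nonnegative.\<close>

lemma lambda2_strictly_convex:
  assumes M: "M > 2/3" and uv: "u > 0" "v > 0" "u + v = 1" and xy: "x > 0" "y > 0" "x \<noteq> y"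
  shows "lambda2 M (u * x + v * y) < u * lambda2 M x + v * lambda2 M y"
proof -
  define z where "z = u * x + v * y"
  define s where "s = sqrt (9 * M\<^sup>2 + 6 * M - 8)"
  define f where "f t = 3 * (1/t)^3" for t :: real
  define g where "g t = s * (1/t)\<^sup>2" for t :: real
  have s: "s \<ge> 0" using M by (simp add: s_def sqrt_arg_factor)
  have z: "z > 0" using uv xy by (simp add: z_def add_pos_pos)
  have uv': "1 - v = u" using uv by simp
  have inv: "1 / z < u * (1/x) + v * (1/y)"
    unfolding z_def by (rule strictly_convex_inverse[OF uv xy])
  \<comment> \<open>Strictness comes from the inequality for the reciprocal; the power itself
    contributes only ordinary convexity on the nonnegative half-line.\<close>
  have pow: "(1 / z) ^ n < u * (1/x)^n + v * (1/y)^n" if "n > 0" for n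
  proof -
    have "(1 / z) ^ n < (u * (1/x) + v * (1/y)) ^ n"
      using inv z that by (intro power_strict_mono) auto
    also have "\<dots> \<le> u * (1/x)^n + v * (1/y)^n"
      using convex_onD[OF convex_on_power_nonneg[of n], of v "1/x" "1/y"] uv' xy uv
      by simp
    finally show ?thesis .
  qed
  have f: "f z < u * f x + v * f y" using pow[of 3] by (simp add: f_def)
  have "s * (1/z)\<^sup>2 \<le> s * (u * (1/x)\<^sup>2 + v * (1/y)\<^sup>2)"
    using s pow[of 2] by (intro mult_left_mono) auto
  then have g: "g z \<le> u * g x + v * g y" by (simp add: g_def algebra_simps)
  \<comment> \<open>The Euclidean norm is monotone in nonnegative entries and subadditive, hence the
    norm of \<open>(f, g)\<close> is convex. Strictness enters only with the extra summand
    \<open>f\<close> at the end.\<close>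
  have "sqrt ((f z)\<^sup>2 + (g z)\<^sup>2) \<le> sqrt ((u * f x + v * f y)\<^sup>2 + (u * g x + v * g y)\<^sup>2)"
    using f g z s by (intro real_sqrt_le_mono add_mono power_mono) (auto simp: f_def g_def)
  also have "\<dots> \<le> sqrt ((u * f x)\<^sup>2 + (u * g x)\<^sup>2) + sqrt ((v * f y)\<^sup>2 + (v * g y)\<^sup>2)"
    by (rule real_sqrt_sum_squares_triangle_ineq)
  also have "sqrt ((u * f x)\<^sup>2 + (u * g x)\<^sup>2) = u * sqrt ((f x)\<^sup>2 + (g x)\<^sup>2)"
    using uv by (simp add: power_mult_distrib real_sqrt_mult flip: distrib_left)
  also have "sqrt ((v * f y)\<^sup>2 + (v * g y)\<^sup>2) = v * sqrt ((f y)\<^sup>2 + (g y)\<^sup>2)"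
    using uv by (simp add: power_mult_distrib real_sqrt_mult flip: distrib_left)
  finally have "sqrt ((f z)\<^sup>2 + (g z)\<^sup>2) + f z
      < u * (sqrt ((f x)\<^sup>2 + (g x)\<^sup>2) + f x) + v * (sqrt ((f y)\<^sup>2 + (g y)\<^sup>2) + f y)"
    using f by (simp add: algebra_simps)
  then have "(3 * M - 2) * lambda2 M z < u * ((3 * M - 2) * lambda2 M x) + v * ((3 * M - 2) * lambda2 M y)"
    using lambda2_eq[OF M] xy z by (simp add: f_def g_def s_def)
  then have "(3 * M - 2) * lambda2 M z < (3 * M - 2) * (u * lambda2 M x + v * lambda2 M y)"
    by (simp add: algebra_simps)
  then show ?thesis using M by (simp add: z_def)
qed

text \<open>Replacing the root by 0 leaves this bound. It yields positivity of
  \<open>lambda2 M\<close> and the blow-up of \<open>ell M\<close> at 0.\<close>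

lemma lambda2_lower_bound:
  assumes "M > 2/3" "x > 0"
  shows "3 / ((3 * M - 2) * x^3) \<le> lambda2 M x"
proof -
  have "3 / ((3 * M - 2) * x^3) = 3 * x / ((3 * M - 2) * x^4)"
    using assms by (simp add: field_simps eval_nat_numeral)
  also have "\<dots> \<le> lambda2 M x"
    using assms by (simp add: lambda2_def divide_right_mono sqrt_arg_factor)
  finally show ?thesis .
qed

lemma lambda2_pos:
  assumes "M > 2/3" "x > 0"
  shows "lambda2 M x > 0"
  using assms by (simp add: less_le_trans[OF _ lambda2_lower_bound])

section \<open>The quadratic defining the branch, its sign, and monotonicity\<close>

definition F_Biot :: "real \<Rightarrow> real \<Rightarrow> real \<Rightarrow> real" where
  "F_Biot M x y = pressure M (x * x * y) - x * y"

text \<open>Times 6, the residual is the quadratic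
  \<open>(3*M - 2) * x^4 * y^2 - 6 * x * y - (3*M + 4)\<close> in \<open>y\<close>, whose roots have
  opposite signs. The positive root is \<open>lambda2 M x\<close>, the negative one is
  \<open>- w / ((3*M - 2) * x^4)\<close>, so the second factor is positive for y > 0.\<close>

lemma F_Biot_factor:
  assumes "M > 2/3" "x > 0"
  obtains w where "w > 0" "\<And>y. y > 0 \<Longrightarrow> 
    6 * F_Biot M x y = (y - lambda2 M x) * ((3 * M - 2) * x^4 * y + w)"
proof -
  define R where "R = sqrt ((9 * M^2 + 6 * M - 8) * x^4 + 9 * x^2)"
  have "(9 * M^2 + 6 * M - 8) * x^4 > 0" using assms by (simp add: sqrt_arg_factor)
  then have "sqrt (9 * x^2) < R" and R2: "R\<^sup>2 = (9 * M^2 + 6 * M - 8) * x^4 + 9 * x^2"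
    using assms by (simp_all add: R_def)
  then have R: "3 * x < R" using assms by (simp add: real_sqrt_mult)
  define L where "L = lambda2 M x"
  have L: "L * ((3 * M - 2) * x^4) = R + 3 * x"
    using assms by (simp add: L_def lambda2_def R_def)
  show ?thesis
  proof (rule that)
    show "R - 3 * x > 0" using R by simp
    fix y :: real
    \<comment> \<open>The constant coefficient, in the manner of Vieta:
      \<open>(R + 3*x) * (R - 3*x)\<close> is \<open>R^2 - 9*x^2\<close>, and
      \<open>sqrt_arg_factor\<close> lets \<open>(3*M - 2) * x^4\<close> cancel.\<close>
    have "L * ((3 * M - 2) * x^4) * (R - 3 * x) = (3 * M - 2) * x^4 * (3 * M + 4)"
      unfolding L using R2 by (simp add: algebra_simps power2_eq_square sqrt_arg_factor)
    moreover have "(3 * M - 2) * x^4 > 0" using assms by simp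
    ultimately have L': "(3 * M - 2) * x^4 * (L * (R - 3 * x)) = (3 * M - 2) * x^4 * (3 * M + 4)"
      and "(3 * M - 2) * x^4 \<noteq> 0"
      by (simp_all only: mult_ac)
    then have Lw: "L * (R - 3 * x) = 3 * M + 4"
      using L' mult_left_cancel by blast
    have "(y - L) * ((3 * M - 2) * x^4 * y + (R - 3 * x)) =
      (3 * M - 2) * x^4 * y\<^sup>2 + y * (R - 3 * x) - y * (L * ((3 * M - 2) * x^4)) - L * (R - 3 * x)"
      by (simp add: algebra_simps power2_eq_square)
    also have "\<dots> = 6 * F_Biot M x y"
      unfolding L Lw
      by (simp add: F_Biot_def pressure_def power2_eq_square eval_nat_numeral algebra_simps)
    finally show "6 * F_Biot M x y = (y - lambda2 M x) * ((3 * M - 2) * x^4 * y + (R - 3 * x))"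
      by (simp add: L_def)
  qed
qed

text \<open>The sign criterion locates a point relative to the graph of \<open>lambda2 M\<close>
  without evaluating a square root.\<close>

lemma F_Biot_sign:
  assumes "M > 2/3" "x > 0" "y > 0"
  shows "F_Biot M x y = 0 \<longleftrightarrow> y = lambda2 M x" and "F_Biot M x y > 0 \<longleftrightarrow> y > lambda2 M x"
proof -
  obtain w where w: "w > 0" "6 * F_Biot M x y = (y - lambda2 M x) * ((3 * M - 2) * x^4 * y + w)"
    using F_Biot_factor[OF assms(1,2)] assms(3) by blast
  have p: "(3 * M - 2) * x^4 * y + w > 0" using assms w by (simp add: add_pos_pos)
  have "F_Biot M x y = 0 \<longleftrightarrow> 6 * F_Biot M x y = 0" by simp
  then show "F_Biot M x y = 0 \<longleftrightarrow> y = lambda2 M x" unfolding w(2) using p by auto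
  have "F_Biot M x y > 0 \<longleftrightarrow> 6 * F_Biot M x y > 0" by simp
  then show "F_Biot M x y > 0 \<longleftrightarrow> y > lambda2 M x" unfolding w(2) using p by (simp add: zero_less_mult_iff)
qed

lemma lambda2_strict_antimono:
  assumes "M > 2/3" "0 < x" "x < y"
  shows "lambda2 M y < lambda2 M x"
proof -
  have "1 / y < 1 / x" using assms by (simp add: field_simps)
  then have "(1 / y) ^ n < (1 / x) ^ n" if "n > 0" for n
    using assms that by (intro power_strict_mono) auto
  from this[of 2] this[of 3] have "(3 * M - 2) * lambda2 M y < (3 * M - 2) * lambda2 M x"
    using assms unfolding lambda2_eq[OF assms(1,2)] lambda2_eq[OF assms(1) less_trans[OF assms(2,3)]]
    by (intro add_le_less_mono real_sqrt_le_mono add_mono power_mono mult_left_mono)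
       (auto simp: sqrt_arg_factor intro: frac_le)
  then show ?thesis using assms by simp
qed

section \<open>Convexity and limits of \<open>ell\<close>\<close>

lemma ell_pos: "\<lbrakk>M > 2/3; x > 0\<rbrakk> \<Longrightarrow> ell M x > 0"
  by (simp add: ell_eq lambda2_pos add_pos_pos)

lemma ell_strictly_convex:
  assumes "M > 2/3" "u > 0" "v > 0" "u + v = 1" "x > 0" "y > 0" "x \<noteq> y"
  shows "ell M (u * x + v * y) < u * ell M x + v * ell M y"
  using lambda2_strictly_convex[OF assms] assms by (simp add: ell_eq add_pos_pos algebra_simps)

lemma ell_convex:
  assumes "M > 2/3"
  shows "convex_on {0<..} (ell M)"
proof
  fix t x y :: real
  assume "t > 0" "t < 1" "x \<in> {0<..}" "y \<in> {0<..}"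
  then show "ell M ((1 - t) *\<^sub>R x + t *\<^sub>R y) \<le> (1 - t) * ell M x + t * ell M y"
    using ell_strictly_convex[OF assms, of "1 - t" t x y]
    by (cases "x = y") (auto simp: algebra_simps)
qed simp

lemma ell_at_top:
  assumes "M > 2/3"
  shows "filterlim (ell M) at_top at_top"
proof (rule filterlim_at_top_mono[OF filterlim_ident])
  show "eventually (\<lambda>x. x \<le> ell M x) at_top"
    using eventually_gt_at_top[of 0]
    by eventually_elim (use assms in \<open>simp add: ell_eq lambda2_pos less_imp_le\<close>)
qed

lemma ell_at_right_0:
  assumes "M > 2/3"
  shows "filterlim (ell M) at_top (at_right 0)"
proof (rule filterlim_at_top_mono)
  have "filterlim (\<lambda>x::real. inverse (x ^ 3)) at_top (at_right 0)"
    by (intro filterlim_compose[OF filterlim_inverse_at_top_right] filterlim_at_withinI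
          tendsto_eq_intros eventually_at_rightI[of 0 1]) auto
  then have "filterlim (\<lambda>x. 3 / (3 * M - 2) * inverse (x ^ 3)) at_top (at_right 0)"
    using assms by (intro filterlim_tendsto_pos_mult_at_top[OF tendsto_const]) auto
  then show "filterlim (\<lambda>x. 3 / ((3 * M - 2) * x ^ 3)) at_top (at_right 0)"
    by (simp add: field_simps)
  show "eventually (\<lambda>x. 3 / ((3 * M - 2) * x ^ 3) \<le> ell M x) (at_right 0)"
    using eventually_at_right_less[of 0]
  proof eventually_elim
    case (elim x)
    then show ?case using lambda2_lower_bound[of M x] assms by (simp add: ell_eq)
  qed
qed

section \<open>Existence and uniqueness of the radial solution\<close>

lemma radial_equation_ex1:
  assumes "M > 2/3"
  shows "\<exists>!x. x > 0 \<and> x + pressure M (x * x * x) / x = \<alpha>"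
proof -
  define c where "c = M/2 - 1/3"
  have c: "c > 0" using assms by (simp add: c_def)
  \<comment> \<open>With \<open>d = x^3\<close> the radial equation splits into these two increasing
    summands, which gives uniqueness; both vanish at 1, so they have the same sign on each side of
    it.\<close>
  define p where "p x = (x - 1/x) + c * (x^5 - 1/x)" for x :: real
  have p: "x + pressure M (x * x * x) / x = p x" if "x > 0" for x
    using that by (simp add: p_def pressure_def c_def[symmetric] field_simps eval_nat_numeral)
  have mono: "p x < p y" if "0 < x" "x < y" for x y
  proof -
    have "x - 1/x < y - 1/y" using that by (smt (verit) frac_less2)
    moreover have "x^5 - 1/x \<le> y^5 - 1/y"
      using that by (intro diff_mono power_mono frac_le) auto
    ultimately show ?thesis unfolding p_def using c by (intro add_less_le_mono mult_left_mono) auto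
  qed
  \<comment> \<open>The points are reciprocal. From 1 / b \<le> 1 one gets \<open>b - 1/b\<close>
    \<ge> \<open>\<bar>\<alpha>\<bar>\<close>, and symmetrically at \<open>a\<close>, so they
    bracket \<alpha>; the summand with \<open>c\<close> only helps.\<close>
  define a b where "a = 1 / (1 + \<bar>\<alpha>\<bar>)" and "b = 1 + \<bar>\<alpha>\<bar>"
  have a: "0 < a" "a \<le> 1" and b: "b \<ge> 1" by (auto simp: a_def b_def)
  have "a^5 \<le> 1" "1 / a \<ge> 1" using a by (auto intro: power_le_one)
  then have "c * (a^5 - 1/a) \<le> 0" using c by (simp add: mult_nonneg_nonpos)
  moreover have "1 / a = 1 + \<bar>\<alpha>\<bar>" by (simp add: a_def)
  ultimately have pa: "p a \<le> \<alpha>" using a by (simp add: p_def)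
  have "b^5 \<ge> 1" "1 / b \<le> 1" using b by (auto intro: one_le_power)
  then have "c * (b^5 - 1/b) \<ge> 0" using c by simp
  moreover have "b - 1 / b \<ge> \<alpha>" using \<open>1 / b \<le> 1\<close> unfolding b_def by linarith
  ultimately have pb: "p b \<ge> \<alpha>" by (simp add: p_def)
  have "continuous_on {a..b} p" unfolding p_def using a by (intro continuous_intros) auto
  then obtain x where "a \<le> x" "p x = \<alpha>" using IVT'[of p a \<alpha> b] pa pb a b by auto
  with a have "x > 0 \<and> x + pressure M (x * x * x) / x = \<alpha>" by (simp add: p)
  moreover have "y = x" if "y > 0 \<and> y + pressure M (y * y * y) / y = \<alpha>"
    "x > 0 \<and> x + pressure M (x * x * x) / x = \<alpha>" for x y
    using that mono[of x y] mono[of y x] p by (cases x y rule: linorder_cases) auto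
  ultimately show ?thesis by blast
qed

section \<open>Description of the solution sets\<close>

lemma diag3_in_solutions_iff:
  assumes "x > 0" "y > 0"
  shows "diag3 x x y \<in> solutions M \<alpha> \<longleftrightarrow> T_Biot M (diag3 x x y) = \<alpha> *\<^sub>R mat 1"
  using assms by (simp add: solutions_def diag3_in_Sym_pp)

text \<open>Replaces the definite description by a scalar equation, which is legitimate by the
  uniqueness in \<open>radial_equation_ex1\<close>.\<close>

lemma radial_solution_eq_iff:
  assumes "M > 2/3" "\<beta> > 0"
  shows "radial_solution M \<alpha> = diag3 \<beta> \<beta> \<beta> \<longleftrightarrow> \<beta> + pressure M (\<beta> * \<beta> * \<beta>) / \<beta> = \<alpha>"
proof -
  define p where "p x = x + pressure M (x * x * x) / x" for x
  have rad: "is_radial U \<longleftrightarrow> (\<exists>x>0. U = diag3 x x x)" for U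
    by (simp add: is_radial_def scaleR_mat_eq_diag3)
  have sol: "diag3 x x x \<in> solutions M \<alpha> \<longleftrightarrow> p x = \<alpha>" if "x > 0" for x
    using that by (simp add: diag3_in_solutions_iff T_Biot_diag3_iff p_def)
  obtain x where x: "x > 0" "p x = \<alpha>" and uniq: "\<And>y. y > 0 \<Longrightarrow> p y = \<alpha> \<Longrightarrow> y = x"
    using radial_equation_ex1[OF assms(1), of \<alpha>] unfolding p_def by blast
  have "radial_solution M \<alpha> = diag3 x x x"
    unfolding radial_solution_def
  proof (rule the_equality)
    show "diag3 x x x \<in> solutions M \<alpha> \<and> is_radial (diag3 x x x)"
      using x sol rad by blast
    show "U = diag3 x x x" if "U \<in> solutions M \<alpha> \<and> is_radial U" for U
      using that sol uniq unfolding rad by blast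
  qed
  then have "radial_solution M \<alpha> = diag3 \<beta> \<beta> \<beta> \<longleftrightarrow> \<beta> = x" by (auto simp: diag3_eq_iff)
  also have "\<dots> \<longleftrightarrow> p \<beta> = \<alpha>" using x(2) uniq[OF assms(2)] by blast
  finally show ?thesis by (simp only: p_def)
qed

lemma radial_solution_obtain:
  assumes "M > 2/3"
  obtains \<beta> where "\<beta> > 0" "radial_solution M \<alpha> = diag3 \<beta> \<beta> \<beta>"
proof -
  obtain \<beta> where "\<beta> > 0" "\<beta> + pressure M (\<beta> * \<beta> * \<beta>) / \<beta> = \<alpha>"
    using radial_equation_ex1[OF assms, of \<alpha>] by blast
  then show ?thesis using that radial_solution_eq_iff[OF assms] by blast
qed

text \<open>Subtracting the scalar equations and clearing denominators gives
  \<open>(x - y) * (x * y - P) = 0\<close>. The two alternatives overlap where the branch meets the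
  radial solutions.\<close>

lemma T_Biot_diag3_cases:
  assumes M: "M > 2/3" and xy: "x > 0" "y > 0"
  shows "T_Biot M (diag3 x x y) = \<alpha> *\<^sub>R mat 1 \<longleftrightarrow>
    (x = y \<and> diag3 x x y = radial_solution M \<alpha>) \<or> (y = lambda2 M x \<and> ell M x = \<alpha>)"
proof -
  define P where "P = pressure M (x * x * y)"
  have l: "y = lambda2 M x \<longleftrightarrow> P = x * y"
    using F_Biot_sign(1)[OF M xy] by (auto simp: F_Biot_def P_def)
  have r: "x = y \<and> diag3 x x y = radial_solution M \<alpha> \<longleftrightarrow> x = y \<and> x + P / x = \<alpha>"
    using radial_solution_eq_iff[OF M xy(1), of \<alpha>] by (auto simp: P_def)
  have e: "y = lambda2 M x \<and> ell M x = \<alpha> \<longleftrightarrow> P = x * y \<and> x + y = \<alpha>"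
    using l ell_eq[OF M xy(1)] by auto
  have "P = x * y" if "x + P / x = y + P / y" "x \<noteq> y"
  proof -
    have "(x - y) * (x * y - P) = 0" using that(1) xy by (simp add: field_simps)
    with that(2) show ?thesis by simp
  qed
  moreover have "x + P / x = x + y" "y + P / y = x + y" if "P = x * y"
    using that xy by simp_all
  ultimately show ?thesis
    unfolding r e T_Biot_diag3_iff[OF xy] P_def[symmetric] by metis
qed

lemma branch_eq_iff: "branch M a = branch M b \<longleftrightarrow> a = b"
  by (auto simp: branch_def diag3_eq_iff)

lemma nonradial_solutions_eq:
  assumes "M > 2/3"
  shows "nonradial_solutions M \<alpha> = branch M ` {x. x > 0 \<and> ell M x = \<alpha> \<and> lambda2 M x \<noteq> x}"
proof (rule set_eqI)
  fix U
  have "U \<in> nonradial_solutions M \<alpha> \<longleftrightarrow>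
      (\<exists>x>0. \<exists>y>0. x \<noteq> y \<and> U = diag3 x x y \<and> diag3 x x y \<in> solutions M \<alpha>)"
    unfolding nonradial_solutions_def by blast
  also have "\<dots> \<longleftrightarrow> (\<exists>x>0. \<exists>y>0. x \<noteq> y \<and> U = diag3 x x y \<and> y = lambda2 M x \<and> ell M x = \<alpha>)"
    using diag3_in_solutions_iff T_Biot_diag3_cases[OF assms] by blast
  also have "\<dots> \<longleftrightarrow> (\<exists>x>0. x \<noteq> lambda2 M x \<and> U = branch M x \<and> ell M x = \<alpha>)"
    unfolding branch_def using lambda2_pos[OF assms] by blast
  finally show "U \<in> nonradial_solutions M \<alpha> \<longleftrightarrow>
      U \<in> branch M ` {x. x > 0 \<and> ell M x = \<alpha> \<and> lambda2 M x \<noteq> x}"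
    unfolding image_iff by auto
qed

lemma axi_solutions_eq:
  assumes "M > 2/3"
  shows "axi_solutions M \<alpha> = insert (radial_solution M \<alpha>) (branch M ` {x. x > 0 \<and> ell M x = \<alpha>})"
proof (rule set_eqI)
  fix U
  obtain \<beta> where \<beta>: "\<beta> > 0" "radial_solution M \<alpha> = diag3 \<beta> \<beta> \<beta>"
    using radial_solution_obtain[OF assms] by blast
  have "U \<in> axi_solutions M \<alpha> \<longleftrightarrow>
      (\<exists>x>0. \<exists>y>0. U = diag3 x x y \<and> diag3 x x y \<in> solutions M \<alpha>)"
    unfolding axi_solutions_def by blast
  also have "\<dots> \<longleftrightarrow> (\<exists>x>0. \<exists>y>0. U = diag3 x x y \<and>
      (x = y \<and> diag3 x x y = radial_solution M \<alpha> \<or> y = lambda2 M x \<and> ell M x = \<alpha>))"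
    using diag3_in_solutions_iff T_Biot_diag3_cases[OF assms] by blast
  also have "\<dots> \<longleftrightarrow> U = radial_solution M \<alpha> \<or> (\<exists>x>0. U = branch M x \<and> ell M x = \<alpha>)"
    unfolding branch_def \<beta>(2) using lambda2_pos[OF assms] \<beta>(1) by blast
  finally show "U \<in> axi_solutions M \<alpha> \<longleftrightarrow>
      U \<in> insert (radial_solution M \<alpha>) (branch M ` {x. x > 0 \<and> ell M x = \<alpha>})"
    unfolding image_iff by auto
qed

text \<open>Decides when the union in \<open>axi_solutions_eq\<close> overlaps, as the cardinality
  claims require.\<close>

lemma branch_eq_radial_solution_iff:
  assumes "M > 2/3" "x > 0" "ell M x = \<alpha>"
  shows "branch M x = radial_solution M \<alpha> \<longleftrightarrow> lambda2 M x = x"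
proof
  assume "branch M x = radial_solution M \<alpha>"
  moreover obtain \<beta> where "radial_solution M \<alpha> = diag3 \<beta> \<beta> \<beta>"
    using radial_solution_obtain[OF assms(1)] by blast
  ultimately show "lambda2 M x = x" by (auto simp: branch_def diag3_eq_iff)
next
  assume l: "lambda2 M x = x"
  then have "F_Biot M x x = 0" using F_Biot_sign(1)[OF assms(1,2,2)] by simp
  then have "pressure M (x * x * x) / x = x" using assms by (simp add: F_Biot_def field_simps)
  then have "x + pressure M (x * x * x) / x = \<alpha>" using assms l by (simp add: ell_eq)
  then show "branch M x = radial_solution M \<alpha>"
    using radial_solution_eq_iff[OF assms(1,2), of \<alpha>] l by (simp add: branch_def)
qed

section \<open>Crossing of the branch with the radial solutions\<close>

lemma lambda2_fixed_point:
  assumes "M > 2/3"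
  obtains x0 where "x0 > 0" "\<And>x. x > 0 \<Longrightarrow> lambda2 M x = x \<longleftrightarrow> x = x0"
    "ell M (3/2 * x0) < ell M x0"
proof -
  define c where "c = M/2 - 1/3"
  have c: "c > 0" using assms by (simp add: c_def)
  have F: "F_Biot M x y = c * ((x * x * y)\<^sup>2 - 1) - 1 - x * y" for x y
    by (simp add: F_Biot_def pressure_def c_def)
  \<comment> \<open>Since \<open>b - 1\<close> divides \<open>b^6 - 1\<close>, the choice
    \<open>c * (b - 1) = 2\<close> makes the sixth-order term dominate
    \<open>1 + b * b\<close>.\<close>
  define b where "b = 1 + 2 / c"
  have b: "b > 1" "c * (b - 1) = 2" using c by (auto simp: b_def)
  have "F_Biot M b b \<ge> 0"
  proof -
    have "c * ((b * b * b)\<^sup>2 - 1) = (c * (b - 1)) * ((b\<^sup>2 + b + 1) * (b^3 + 1))"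
      by (simp add: algebra_simps eval_nat_numeral)
    also have "\<dots> = 2 * ((b\<^sup>2 + b + 1) * (b^3 + 1))" using b by simp
    also have "\<dots> \<ge> 2 * ((b\<^sup>2 + b + 1) * 1)" using b by (intro mult_left_mono) auto
    finally have "c * ((b * b * b)\<^sup>2 - 1) \<ge> 2 * (b\<^sup>2 + b + 1)" by simp
    moreover have "2 * (b\<^sup>2 + b + 1) \<ge> 1 + b * b" using b by (simp add: power2_eq_square algebra_simps add_nonneg_nonneg)
    ultimately show ?thesis unfolding F by linarith
  qed
  \<comment> \<open>Although 0 is no admissible stretch, the polynomial residual is defined there;
    its negative value also keeps the root away from 0.\<close>
  moreover have "F_Biot M 0 0 < 0" using c by (simp add: F)
  moreover have "continuous_on {0..b} (\<lambda>x. F_Biot M x x)"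
    unfolding F by (intro continuous_intros)
  ultimately obtain x0 where x0: "0 \<le> x0" "F_Biot M x0 x0 = 0"
    using IVT'[of "\<lambda>x. F_Biot M x x" 0 0 b] b by auto
  with \<open>F_Biot M 0 0 < 0\<close> have pos: "x0 > 0" by (cases "x0 = 0") auto
  have fix0: "lambda2 M x0 = x0" using F_Biot_sign(1)[OF assms pos pos] x0 by simp
  show ?thesis
  proof (rule that[OF pos])
    fix x :: real assume "x > 0"
    \<comment> \<open>A strictly decreasing function meets the identity at most once.\<close>
    then show "lambda2 M x = x \<longleftrightarrow> x = x0"
      using lambda2_strict_antimono[OF assms, of x x0] lambda2_strict_antimono[OF assms, of x0 x] pos fix0
      by (cases x x0 rule: linorder_cases) auto
  next
    \<comment> \<open>The level line \<open>x + y = 2 * x0\<close> at \<open>x = 3/2 * x0\<close> lies strictly above the branch, because \<open>(3/2)^2 * (1/2) > 1\<close>.\<close>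
    have "F_Biot M (3/2 * x0) (1/2 * x0) = c * (81/64 * (x0 * x0 * x0)\<^sup>2 - 1) - 1 - 3/4 * (x0 * x0)"
      unfolding F by (simp add: power2_eq_square algebra_simps)
    also have "\<dots> = F_Biot M x0 x0 + c * (17/64 * (x0 * x0 * x0)\<^sup>2) + 1/4 * (x0 * x0)"
      unfolding F by (simp add: algebra_simps)
    also have "\<dots> > 0" using x0 pos c by (simp add: add_pos_pos)
    finally have "lambda2 M (3/2 * x0) < 1/2 * x0"
      using F_Biot_sign(2)[OF assms, of "3/2 * x0" "1/2 * x0"] pos by simp
    then show "ell M (3/2 * x0) < ell M x0" using pos fix0 assms by (simp add: ell_eq)
  qed
qed

section \<open>Counting the solutions\<close>

theorem mainTheorem6:
  fixes M :: real
  assumes "M > 2/3"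
  shows
    "(\<forall>\<alpha>. \<exists>!\<beta>. \<beta> > 0 \<and> T_Biot M (\<beta> *\<^sub>R mat 1) = \<alpha> *\<^sub>R mat 1) \<and>
     (\<forall>\<alpha>. radial_solution M \<alpha> \<in> axi_solutions M \<alpha> \<and> is_radial (radial_solution M \<alpha>)) \<and>
     (\<forall>\<alpha> x y. x > 0 \<longrightarrow> y > 0 \<longrightarrow>
        (T_Biot M (diag3 x x y) = \<alpha> *\<^sub>R mat 1 \<longleftrightarrow>
          (x = y \<and> diag3 x x y = radial_solution M \<alpha>) \<or>
          (y = lambda2 M x \<and> ell M x = \<alpha>))) \<and>
     ell M ` {0<..} \<subseteq> {0<..} \<and>
     convex_on {0<..} (ell M) \<and>
     filterlim (ell M) at_top (at_right 0) \<and>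
     filterlim (ell M) at_top at_top \<and>
     (ell_min M \<in> ell M ` {0<..} \<and> (\<forall>x>0. ell_min M \<le> ell M x)) \<and>
     (\<forall>\<alpha> < ell_min M.
        {x. x > 0 \<and> ell M x = \<alpha>} = {} \<and>
        axi_solutions M \<alpha> = {radial_solution M \<alpha>}) \<and>
     (\<forall>\<alpha>. \<alpha> = ell_min M \<longrightarrow>
        (\<exists>a. {x. x > 0 \<and> ell M x = \<alpha>} = {a} \<and>
          nonradial_solutions M \<alpha> = {branch M a} \<and>
          axi_solutions M \<alpha> = {radial_solution M \<alpha>, branch M a} \<and>
          card (axi_solutions M \<alpha>) = 2)) \<and>
     (\<exists>\<alpha>0 > ell_min M. \<forall>\<alpha> > ell_min M.
        \<exists>a b. a < b \<and> {x. x > 0 \<and> ell M x = \<alpha>} = {a, b} \<and>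
          axi_solutions M \<alpha> = {radial_solution M \<alpha>, branch M a, branch M b} \<and>
          (\<alpha> \<noteq> \<alpha>0 \<longrightarrow>
            nonradial_solutions M \<alpha> = {branch M a, branch M b} \<and>
            card (nonradial_solutions M \<alpha>) = 2 \<and>
            card (axi_solutions M \<alpha>) = 3) \<and>
          (\<alpha> = \<alpha>0 \<longrightarrow>
            branch M a = radial_solution M \<alpha> \<and>
            nonradial_solutions M \<alpha> = {branch M b}))"
proof -
  obtain m where m: "m > 0" "\<And>x. x > 0 \<Longrightarrow> x \<noteq> m \<Longrightarrow> ell M m < ell M x"
    "\<And>\<alpha>. \<alpha> > ell M m \<Longrightarrow> \<exists>a b. 0 < a \<and> a < m \<and> m < b \<and> {x. x > 0 \<and> ell M x = \<alpha>} = {a, b} \<and>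
      (\<forall>x>b. ell M x > \<alpha>)"
    \<comment> \<open>Continuity of \<open>ell M\<close> follows from its convexity on the open
      half-line.\<close>
    using strictly_convex_coercive_levels[OF convex_on_continuous[OF open_greaterThan ell_convex[OF assms]]
        ell_strictly_convex[OF assms] ell_at_right_0[OF assms] ell_at_top[OF assms]] by blast
  have min: "ell M m \<le> ell M x" if "x > 0" for x using m(2)[OF that] by (cases "x = m") auto
  have ell_min: "ell_min M = ell M m"
    unfolding ell_min_def using min m(1) by (intro Least_equality) auto
  obtain x0 where x0: "x0 > 0" "\<And>x. x > 0 \<Longrightarrow> lambda2 M x = x \<longleftrightarrow> x = x0"
    "ell M (3/2 * x0) < ell M x0"
    using lambda2_fixed_point[OF assms] by blast
  have \<alpha>0: "ell M m < ell M x0" using min[of "3/2 * x0"] x0 by simp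
  note axi = axi_solutions_eq[OF assms] and nonrad = nonradial_solutions_eq[OF assms]
  \<comment> \<open>Non-radiality removes just the crossing point \<open>x0\<close> from a level
    set, so only the level \<open>ell M x0\<close> is exceptional; this is the witness for
    \<open>\<alpha>0\<close>.\<close>
  have nonrad': "nonradial_solutions M \<alpha> = branch M ` ({x. x > 0 \<and> ell M x = \<alpha>} - {x0})" for \<alpha>
    unfolding nonrad using x0(2) by (intro arg_cong[where f = "image (branch M)"]) auto
  have rad: "branch M x = radial_solution M \<alpha> \<longleftrightarrow> x = x0" if "x > 0" "ell M x = \<alpha>" for x \<alpha>
    using branch_eq_radial_solution_iff[OF assms that] x0(2) that by simp

  have 1: "\<exists>!\<beta>. \<beta> > 0 \<and> T_Biot M (\<beta> *\<^sub>R mat 1) = \<alpha> *\<^sub>R mat 1" for \<alpha>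
  proof -
    have "\<beta> > 0 \<and> T_Biot M (\<beta> *\<^sub>R mat 1) = \<alpha> *\<^sub>R mat 1 \<longleftrightarrow>
        \<beta> > 0 \<and> \<beta> + pressure M (\<beta> * \<beta> * \<beta>) / \<beta> = \<alpha>" for \<beta>
      unfolding scaleR_mat_eq_diag3[of \<beta>] using T_Biot_diag3_iff[of \<beta> \<beta> M \<alpha>] by auto
    then show ?thesis using radial_equation_ex1[OF assms, of \<alpha>] by simp
  qed
  have 2: "radial_solution M \<alpha> \<in> axi_solutions M \<alpha> \<and> is_radial (radial_solution M \<alpha>)" for \<alpha>
  proof -
    obtain \<beta> where "\<beta> > 0" "radial_solution M \<alpha> = diag3 \<beta> \<beta> \<beta>"
      using radial_solution_obtain[OF assms] by blast
    then show ?thesis by (auto simp: axi is_radial_def scaleR_mat_eq_diag3)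
  qed
  have 3: "{x. x > 0 \<and> ell M x = \<alpha>} = {} \<and> axi_solutions M \<alpha> = {radial_solution M \<alpha>}"
    if "\<alpha> < ell_min M" for \<alpha>
  proof -
    have "{x. x > 0 \<and> ell M x = \<alpha>} = {}" using that min by (fastforce simp: ell_min)
    then show ?thesis unfolding axi by (simp only: image_empty simp_thms)
  qed
  have 4: "\<exists>a. {x. x > 0 \<and> ell M x = \<alpha>} = {a} \<and> nonradial_solutions M \<alpha> = {branch M a} \<and>
          axi_solutions M \<alpha> = {radial_solution M \<alpha>, branch M a} \<and> card (axi_solutions M \<alpha>) = 2"
    if "\<alpha> = ell_min M" for \<alpha>
  proof -
    have l: "{x. x > 0 \<and> ell M x = \<alpha>} = {m}" using that m by (force simp: ell_min)
    \<comment> \<open>The crossing lies strictly above the minimum level, so the branch point at the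
      minimiser is non-radial.\<close>
    moreover have "m \<noteq> x0" using \<alpha>0 by auto
    ultimately show ?thesis
      using rad[of m \<alpha>] that m(1)
      by (intro exI[of _ m]) (auto simp: axi nonrad' l ell_min card_insert_if)
  qed
  have 5: "\<exists>a b. a < b \<and> {x. x > 0 \<and> ell M x = \<alpha>} = {a, b} \<and>
          axi_solutions M \<alpha> = {radial_solution M \<alpha>, branch M a, branch M b} \<and>
          (\<alpha> \<noteq> ell M x0 \<longrightarrow>
            nonradial_solutions M \<alpha> = {branch M a, branch M b} \<and>
            card (nonradial_solutions M \<alpha>) = 2 \<and>
            card (axi_solutions M \<alpha>) = 3) \<and>
          (\<alpha> = ell M x0 \<longrightarrow>
            branch M a = radial_solution M \<alpha> \<and>
            nonradial_solutions M \<alpha> = {branch M b})"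
    if "\<alpha> > ell_min M" for \<alpha>
  proof -
    obtain a b where ab: "a < m" "m < b" and l: "{x. x > 0 \<and> ell M x = \<alpha>} = {a, b}"
      and above: "\<forall>x>b. ell M x > \<alpha>"
      using m(3)[of \<alpha>] \<open>\<alpha> > ell_min M\<close> unfolding ell_min by metis
    have lev: "a > 0" "ell M a = \<alpha>" "b > 0" "ell M b = \<alpha>" using l by auto
    have A: "axi_solutions M \<alpha> = {radial_solution M \<alpha>, branch M a, branch M b}"
      unfolding axi l by simp
    show ?thesis
    proof (cases "\<alpha> = ell M x0")
      case True
      then have "x0 \<in> {a, b}" unfolding l[symmetric] using x0(1) by simp
      \<comment> \<open>To the right of \<open>b\<close> all values exceed \<alpha>, whereas
        \<open>ell M\<close> drops below \<alpha> at \<open>3/2 * x0\<close>. Hence the crossing is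
        the smaller preimage.\<close>
      moreover have "x0 \<noteq> b"
      proof
        assume "x0 = b"
        then have "ell M (3/2 * x0) > \<alpha>" using above x0(1) by simp
        with x0(3) True show False by simp
      qed
      ultimately have "x0 = a" by simp
      then show ?thesis using ab l A True rad[OF lev(1,2)] unfolding nonrad' l
        by (intro exI[of _ a] exI[of _ b]) auto
    next
      case False
      then have ne: "a \<noteq> x0" "b \<noteq> x0" using lev by auto
      then have "radial_solution M \<alpha> \<noteq> branch M a" "radial_solution M \<alpha> \<noteq> branch M b"
        using rad[OF lev(1,2)] rad[OF lev(3,4)] by metis+
      moreover have "branch M a \<noteq> branch M b" using ab by (simp add: branch_eq_iff)
      moreover have "nonradial_solutions M \<alpha> = {branch M a, branch M b}"
        unfolding nonrad' l using ne by auto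
      ultimately show ?thesis using ab l A False by (intro exI[of _ a] exI[of _ b]) auto
    qed
  qed
  show ?thesis
  proof (intro conjI)
    show "\<exists>\<alpha>0 > ell_min M. \<forall>\<alpha> > ell_min M.
        \<exists>a b. a < b \<and> {x. x > 0 \<and> ell M x = \<alpha>} = {a, b} \<and>
          axi_solutions M \<alpha> = {radial_solution M \<alpha>, branch M a, branch M b} \<and>
          (\<alpha> \<noteq> \<alpha>0 \<longrightarrow>
            nonradial_solutions M \<alpha> = {branch M a, branch M b} \<and>
            card (nonradial_solutions M \<alpha>) = 2 \<and>
            card (axi_solutions M \<alpha>) = 3) \<and>
          (\<alpha> = \<alpha>0 \<longrightarrow>
            branch M a = radial_solution M \<alpha> \<and>
            nonradial_solutions M \<alpha> = {branch M b})"
      using 5 \<alpha>0 unfolding ell_min by blast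
  qed (use 1 2 3 4 T_Biot_diag3_cases[OF assms] ell_pos[OF assms] ell_convex[OF assms]
      ell_at_right_0[OF assms] ell_at_top[OF assms] min m(1) ell_min in \<open>auto\<close>)
qed

end
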